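(* Let $\alpha>0$, $H\in(1/2,1)$, $\epsilon>0$, and let $(\beta_t)_{0\le t\le 1}$ be an $\mathbb{R}^n$-valued function. For $r\in(-\epsilon,\epsilon)$ put $$B_t^H(r)=B_t^H+r\int_0^t\beta_s\,ds .$$ Suppose that for every $r\in(-\epsilon,\epsilon)$ the stochastic differential equation $$dX_t(r)=-\alpha X_t(r)\,dt+dB_t^H(r)$$ has a solution $(X_t(r))_{0\le t\le 1}$ such that: 1. $(X_t(r))_{0\le t\le 1}\in\Omega$ for every $r$; 2. the derivative $\frac{d}{dr}X_t(r)\big|_{r=0}$ exists and $(Kh)_t=\frac{d}{dr}X_t(r)\big|_{r=0}$ for some $(h_t)_{0\le t\le 1}\in L^2(\Omega;\nu)$. Then $$\beta_t=(Kh)_t'+\alpha (Kh)_t ,$$ where $(Kh)'_t$ denotes the derivative of $Kh$ with respect to $t$.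
   Context: $\Omega$ is the space of $\mathbb{R}^n$-valued continuous functions on $[0,1]$ with initial value zero, with the topology of local uniform convergence. $(B^H_t)_{0\le t\le1}$ is an $n$-dimensional fractional Brownian motion with Hurst parameter $H\in(1/2,1)$. $\nu$ is the fractional Ornstein-Uhlenbeck measure on $\Omega$, i.e. the probability measure under which the coordinate process $X_t(\omega)=\omega_t$ satisfies $dX_t=-\alpha X_t\,dt+dB^H_t$, $X_0=0$. $\mathcal F$ is the $\nu$-completion of the Borel $\sigma$-algebra of $\Omega$ and $(\mathcal F_t)$ is the $\nu$-completed natural filtration of $\omega$. At $r=0$ one has $X_t(0)=X_t$ and $B^H_t(0)=B^H_t$. For an $\mathbb{R}^n$-valued process $h=(h_t)_{0\le t\le1}$, $h\in L^2(\Omega;\nu)$ means $\mathbb{E}_\nu\left[\int_0^1|h_t|^2dt\right]<\infty$. The function $\beta$, like $h$, may depend on $\omega\in\Omega$. The operator $K$ is defined by $(Kh)_t=\int_0^tK(t,s)h_s\,ds$ with kernel $$K(t,s)=c_H s^{\frac12-H}\int_s^t u^{H-\frac12}(u-s)^{H-\frac32}\,du\; I_{[0,t]}(s),\qquad c_H=\sqrt{\frac{H(2H-1)}{B(2-2H,H-\frac12)}},$$ where $B(\cdot,\cdot)$ in $c_H$ is the beta function and $I_{[0,t]}$ is the indicator function of $[0,t]$. *)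

theory Defs
  imports "HOL-Probability.Probability"
begin

section \<open>Path space\<close>

text \<open>
  Paths are functions on \<open>[0,1]\<close>; following \<^const>\<open>cfunspace\<close> they are extended
  by \<^const>\<open>undefined\<close> outside. The metric is the supremum metric, which on the compact
  interval \<open>[0,1]\<close> induces the topology of (local) uniform convergence.
\<close>

definition path_metric :: "(real \<Rightarrow> real ^ 'n) metric" where
  "path_metric = cfunspace (top_of_set {0..1}) euclidean_metric"

definition Omega :: "(real \<Rightarrow> real ^ 'n) set" where
  "Omega = {\<omega> \<in> mspace path_metric. \<omega> 0 = 0}"

definition Omega_topology :: "(real \<Rightarrow> real ^ 'n) topology" where
  "Omega_topology = subtopology (mtopology_of path_metric) Omega"

definition Omega_borel :: "(real \<Rightarrow> real ^ 'n) measure" where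
  "Omega_borel = sigma Omega {U. openin Omega_topology U}"

section \<open>Fractional Brownian motion\<close>

text \<open>Constants count as (degenerate) Gaussian variables.\<close>

definition gaussian_rv :: "'w measure \<Rightarrow> ('w \<Rightarrow> real) \<Rightarrow> bool" where
  "gaussian_rv M Y \<longleftrightarrow> Y \<in> borel_measurable M \<and>
     ((\<exists>c. AE \<omega> in M. Y \<omega> = c) \<or>
      (\<exists>\<mu> \<sigma>. 0 < \<sigma> \<and> distributed M lborel Y (\<lambda>x. ennreal (normal_density \<mu> \<sigma> x))))"

definition gaussian_process :: "'w measure \<Rightarrow> 'i set \<Rightarrow> ('i \<Rightarrow> 'w \<Rightarrow> real) \<Rightarrow> bool" where
  "gaussian_process M I Y \<longleftrightarrow>
     (\<forall>J c. finite J \<and> J \<subseteq> I \<longrightarrow> gaussian_rv M (\<lambda>\<omega>. \<Sum>i\<in>J. c i * Y i \<omega>))"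

text \<open>
  The \<open>n\<close>-dimensional process is a centred Gaussian process whose components are uncorrelated,
  hence independent, one-dimensional fractional Brownian motions.
\<close>

definition fractional_brownian_motion ::
    "real \<Rightarrow> 'w measure \<Rightarrow> (real \<Rightarrow> 'w \<Rightarrow> real ^ 'n) \<Rightarrow> bool" where
  "fractional_brownian_motion H M B \<longleftrightarrow>
     gaussian_process M ({0..1} \<times> UNIV) (\<lambda>(t, i) \<omega>. B t \<omega> $ i) \<and>
     (\<forall>t\<in>{0..1}. \<forall>i. (\<integral>\<omega>. B t \<omega> $ i \<partial>M) = 0) \<and>
     (\<forall>s\<in>{0..1}. \<forall>t\<in>{0..1}. \<forall>i j.
        (\<integral>\<omega>. B s \<omega> $ i * B t \<omega> $ j \<partial>M) =
          (if i = j then (s powr (2 * H) + t powr (2 * H) - \<bar>t - s\<bar> powr (2 * H)) / 2 else 0)) \<and>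
     (AE \<omega> in M. B 0 \<omega> = 0 \<and> continuous_on {0..1} (\<lambda>t. B t \<omega>))"

section \<open>The Langevin equation and the fractional Ornstein-Uhlenbeck measure\<close>

text \<open>
  The noise is additive, so \<open>dY = - \<alpha> Y dt + dZ\<close> is understood pathwise in integrated form.
\<close>

definition langevin_solution ::
    "real \<Rightarrow> 'w measure \<Rightarrow> (real \<Rightarrow> 'w \<Rightarrow> real ^ 'n) \<Rightarrow> (real \<Rightarrow> 'w \<Rightarrow> real ^ 'n) \<Rightarrow> bool" where
  "langevin_solution \<alpha> M Z Y \<longleftrightarrow>
     (AE \<omega> in M. set_integrable lebesgue {0..1} (\<lambda>s. Y s \<omega>) \<and>
        (\<forall>t\<in>{0..1}. Y t \<omega> - Y 0 \<omega> =
            - (\<alpha> *\<^sub>R (LINT s:{0..t}|lebesgue. Y s \<omega>)) + (Z t \<omega> - Z 0 \<omega>)))"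

text \<open>
  \<open>\<nu>\<close> lives on the Borel sets; \<^term>\<open>completion \<nu>\<close> carries the \<open>\<nu>\<close>-completed \<open>\<sigma>\<close>-algebra.
  The coordinate process starts at \<open>0\<close> because all paths in \<^const>\<open>Omega\<close> do.
\<close>

definition fractional_OU_measure ::
    "real \<Rightarrow> real \<Rightarrow> (real \<Rightarrow> real ^ 'n) measure \<Rightarrow>
     (real \<Rightarrow> (real \<Rightarrow> real ^ 'n) \<Rightarrow> real ^ 'n) \<Rightarrow> bool" where
  "fractional_OU_measure \<alpha> H \<nu> B \<longleftrightarrow>
     prob_space \<nu> \<and> sets \<nu> = sets Omega_borel \<and>
     fractional_brownian_motion H (completion \<nu>) B \<and>
     langevin_solution \<alpha> (completion \<nu>) B (\<lambda>t \<omega>. \<omega> t)"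

definition perturbed ::
    "(real \<Rightarrow> 'w \<Rightarrow> real ^ 'n) \<Rightarrow> (real \<Rightarrow> 'w \<Rightarrow> real ^ 'n) \<Rightarrow> real \<Rightarrow> real \<Rightarrow> 'w \<Rightarrow> real ^ 'n" where
  "perturbed B \<beta> r t \<omega> = B t \<omega> + r *\<^sub>R (LINT s:{0..t}|lebesgue. \<beta> s \<omega>)"

section \<open>Square-integrable processes and the operator \<open>K\<close>\<close>

definition L2_process :: "'w measure \<Rightarrow> (real \<Rightarrow> 'w \<Rightarrow> real ^ 'n) \<Rightarrow> bool" where
  "L2_process M h \<longleftrightarrow>
     (\<lambda>(t, \<omega>). h t \<omega>) \<in> borel_measurable (lebesgue_on {0..1} \<Otimes>\<^sub>M M) \<and>
     (\<integral>\<^sup>+\<omega>. (\<integral>\<^sup>+t. ennreal ((norm (h t \<omega>))\<^sup>2) \<partial>lebesgue_on {0..1}) \<partial>M) < \<infinity>"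

definition c_H :: "real \<Rightarrow> real" where
  "c_H H = sqrt (H * (2 * H - 1) / Beta (2 - 2 * H) (H - 1 / 2))"

text \<open>
  As \<open>0 powr a = 0\<close>, the singular factors take the value \<open>0\<close> at the single points \<open>s = 0\<close>
  and \<open>u = s\<close>, which does not affect the integrals.
\<close>

definition K_kernel :: "real \<Rightarrow> real \<Rightarrow> real \<Rightarrow> real" where
  "K_kernel H t s =
     c_H H * s powr (1 / 2 - H) *
     (LINT u:{s..t}|lebesgue. u powr (H - 1 / 2) * (u - s) powr (H - 3 / 2)) *
     indicator {0..t} s"

definition K_op :: "real \<Rightarrow> (real \<Rightarrow> real ^ 'n) \<Rightarrow> real \<Rightarrow> real ^ 'n" where
  "K_op H f t = (LINT s:{0..t}|lebesgue. K_kernel H t s *\<^sub>R f s)"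

end

theory Submission
  imports Defs
begin

text \<open>
  The noise is additive, so the difference quotients of \<open>r \<mapsto> X r\<close> at \<open>0\<close> all solve one and
  the same linear Volterra equation \<open>D t = \<integral>\<^sub>0\<^sup>t \<beta> - \<alpha> \<integral>\<^sub>0\<^sup>t D\<close>, whose continuous solution is
  unique; hence their limit \<open>K h\<close> solves it as well, and the Lebesgue differentiation theorem
  gives the claim. The exceptional null sets depend on \<open>r\<close> and \<open>t\<close>, so only a sequence of
  values of \<open>r\<close> and a countable dense set of times can be used; the passage to all times needs the
  continuity of \<open>K h\<close>, which follows from the Hoelder estimate
  \<open>\<bar>K(t',s) - K(t,s)\<bar> \<le> C (t' - t)\<^sup>p s\<^sup>-\<^sup>p\<close> with \<open>p = H - 1/2 < 1/2\<close>.
\<close>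

section \<open>Lebesgue differentiation and a linear Volterra equation\<close>

text \<open>Averages over shrinking right-hand and left-hand intervals converge to the value of the
  function off a null set; together they control the increments of the indefinite integral on both
  sides.\<close>

lemma AE_has_vector_derivative_indefinite_integral:
  fixes f :: "real \<Rightarrow> 'a::euclidean_space"
  assumes f: "f integrable_on {a..b}"
  shows "AE t in lebesgue_on {a..b}.
    ((\<lambda>u. integral {a..u} f) has_vector_derivative f t) (at t within {a..b})"
proof -
  \<comment> \<open>Extension by zero makes \<open>g\<close> integrable on every interval, so that
    the averages may be taken over intervals that leave \<open>{a..b}\<close>.\<close>
  define g where "g x = (if x \<in> {a..b} then f x else 0)" for x
  have g_UNIV: "g integrable_on UNIV"
    unfolding g_def integrable_restrict_UNIV by (rule f)
  have g: "g integrable_on cbox c d" for c d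
    by (rule integrable_on_subcbox[OF g_UNIV]) auto
  have g': "(\<lambda>x. g (- x)) integrable_on cbox c d" for c d
    using iffD2[OF integrable_reflect[of g "- c" "- d"] g] by simp
  obtain N where N: "negligible N"
    and right: "\<And>x e. \<lbrakk>x \<notin> N; 0 < e\<rbrakk> \<Longrightarrow> \<exists>d>0. \<forall>h. 0 < h \<and> h < d \<longrightarrow>
      norm (integral (cbox x (x + h *\<^sub>R One)) g /\<^sub>R h ^ DIM(real) - g x) < e"
    using integrable_ccontinuous_explicit[OF g] by blast
  \<comment> \<open>The library result concerns right-hand intervals; the reflected function covers the left.\<close>
  obtain N' where N': "negligible N'"
    and left: "\<And>x e. \<lbrakk>x \<notin> N'; 0 < e\<rbrakk> \<Longrightarrow> \<exists>d>0. \<forall>h. 0 < h \<and> h < d \<longrightarrow>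
      norm (integral (cbox x (x + h *\<^sub>R One)) (\<lambda>x. g (- x)) /\<^sub>R h ^ DIM(real) - g (- x)) < e"
    using integrable_ccontinuous_explicit[OF g'] by blast
  \<comment> \<open>The exceptional set of the reflected function is reflected back; the image of a
    null set under a differentiable map is null.\<close>
  have "negligible (uminus ` N')"
    using N' by (intro negligible_differentiable_image_negligible)
      (auto intro!: derivative_intros simp: differentiable_on_def)
  then have "negligible (N \<union> uminus ` N')" using N by (rule negligible_Un[rotated])
  moreover have "((\<lambda>u. integral {a..u} f) has_vector_derivative f x) (at x within {a..b})"
    if x: "x \<in> {a..b}" and xN: "x \<notin> N \<union> uminus ` N'" for x
  proof -
    \<comment> \<open>Multiplying by the length \<open>h\<close> turns closeness of an average into
      the linear-approximation form of the derivative.\<close>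
    have scale: "norm (J - h *\<^sub>R g x) \<le> e * h" if "norm (J /\<^sub>R h - g x) < e" "0 < h" for J :: 'a and h e :: real
    proof -
      have "J - h *\<^sub>R g x = h *\<^sub>R (J /\<^sub>R h - g x)" using that by (simp add: scaleR_diff_right)
      then have "norm (J - h *\<^sub>R g x) = h * norm (J /\<^sub>R h - g x)" using that by simp
      also have "\<dots> \<le> h * e" using that by (intro mult_left_mono) auto
      finally show ?thesis by (simp add: mult.commute)
    qed
    have gf: "g x = f x" using x by (simp add: g_def)
    have int_gf: "integral {c..d} g = integral {c..d} f" if "a \<le> c" "d \<le> b" for c d
      using that by (intro integral_cong) (auto simp: g_def)
    show ?thesis
      unfolding has_vector_derivative_def has_derivative_within_alt
    proof (intro conjI allI impI)
      fix e :: real assume e: "0 < e"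
      obtain d1 where d1: "d1 > 0" "\<And>h. 0 < h \<and> h < d1 \<Longrightarrow> norm (integral {x..x + h} g /\<^sub>R h - g x) < e"
        using right[of x e] xN e by auto
      have "- x \<notin> N'" using xN by force
      then obtain d2 where d2: "d2 > 0"
        "\<And>h. 0 < h \<and> h < d2 \<Longrightarrow> norm (integral {-x..-x + h} (\<lambda>x. g (- x)) /\<^sub>R h - g x) < e"
        using left[of "- x" e] e by auto
      have d2': "norm (integral {x - h..x} g /\<^sub>R h - g x) < e" if "0 < h" "h < d2" for h
        using d2(2)[of h] that Henstock_Kurzweil_Integration.integral_reflect_real[of x "x - h" g] by simp
      show "\<exists>d>0. \<forall>y\<in>{a..b}. norm (y - x) < d \<longrightarrow>
          norm (integral {a..y} f - integral {a..x} f - (y - x) *\<^sub>R f x) \<le> e * norm (y - x)"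
      proof (intro exI[of _ "min d1 d2"] conjI ballI impI)
        fix y assume y: "y \<in> {a..b}" "norm (y - x) < min d1 d2"
        consider "y = x" | "x < y" | "y < x" by linarith
        then show "norm (integral {a..y} f - integral {a..x} f - (y - x) *\<^sub>R f x) \<le> e * norm (y - x)"
        proof cases
          case 2
          have "integral {a..x} f + integral {x..y} f = integral {a..y} f"
            using x y 2 by (intro Henstock_Kurzweil_Integration.integral_combine integrable_on_subinterval[OF f]) auto
          then have "integral {a..y} f - integral {a..x} f = integral {x..y} f"
            by (simp add: algebra_simps)
          moreover have "norm (integral {x..y} g - (y - x) *\<^sub>R g x) \<le> e * (y - x)"
            using d1(2)[of "y - x"] 2 y by (intro scale) auto
          ultimately show ?thesis using 2 x y int_gf[of x y] gf by auto
        next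
          case 3
          have "integral {a..y} f + integral {y..x} f = integral {a..x} f"
            using x y 3 by (intro Henstock_Kurzweil_Integration.integral_combine integrable_on_subinterval[OF f]) auto
          then have "integral {a..y} f - integral {a..x} f - (y - x) *\<^sub>R f x
              = - (integral {y..x} f - (x - y) *\<^sub>R f x)"
            by (simp add: algebra_simps)
          moreover have "norm (integral {y..x} g - (x - y) *\<^sub>R g x) \<le> e * (x - y)"
            using d2'[of "x - y"] 3 y by (intro scale) auto
          ultimately show ?thesis using 3 x y int_gf[of y x] gf by (simp add: norm_minus_commute)
        qed simp
      qed (use d1 d2 in auto)
    qed (rule bounded_linear_scaleR_left)
  qed
  ultimately have "AE x in lebesgue. x \<in> {a..b} \<longrightarrow>
      ((\<lambda>u. integral {a..u} f) has_vector_derivative f x) (at x within {a..b})"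
    unfolding eventually_ae_filter_negligible by blast
  then show ?thesis by (subst AE_restrict_space_iff) auto
qed

text \<open>Continuity of \<open>y\<close> makes the right-hand side differentiable, so that
  \<open>y' = c y\<close>. With the integrating factor \<open>exp (- c * t)\<close> the derivative
  vanishes, and the resulting constant is zero because \<open>y a = 0\<close>.\<close>

lemma linear_Volterra_unique:
  fixes y :: "real \<Rightarrow> 'a::banach"
  assumes cont: "continuous_on {a..b} y"
    and eq: "\<And>t. t \<in> {a..b} \<Longrightarrow> y t = c *\<^sub>R integral {a..t} y"
    and t: "t \<in> {a..b}"
  shows "y t = 0"
proof -
  have "((\<lambda>t. exp (- c * t) *\<^sub>R y t) has_vector_derivative 0) (at x within {a..b})"
    if x: "x \<in> {a..b}" for x
  proof -
    have "((\<lambda>t. c *\<^sub>R integral {a..t} y) has_vector_derivative c *\<^sub>R y x) (at x within {a..b})"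
      by (intro bounded_linear.has_vector_derivative[OF bounded_linear_scaleR_right]
          integral_has_vector_derivative cont x)
    then have "(y has_vector_derivative c *\<^sub>R y x) (at x within {a..b})"
      by (rule has_vector_derivative_transform[OF x, rotated]) (use eq in auto)
    then show ?thesis
      by (auto intro!: derivative_eq_intros)
  qed
  then obtain z where z: "\<And>x. x \<in> {a..b} \<Longrightarrow> exp (- c * x) *\<^sub>R y x = z"
    by (rule has_vector_derivative_zero_constant[OF convex_closed_interval[of a b]]) auto
  have "y a = 0" using eq[of a] t by simp
  with z[of a] t have "z = 0" by simp
  with z[OF t] show ?thesis by simp
qed

section \<open>Kernel estimates and continuity of \<open>K_op\<close>\<close>

text \<open>The antiderivative \<open>(u - m) powr p / p\<close> is continuous up to
  \<open>m\<close>, although its derivative may blow up there; hence the fundamental theorem is used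
  with differentiability in the interior only.\<close>

lemma has_integral_powr_shift:
  fixes m t p :: real
  assumes "0 < p" "m \<le> t"
  shows "((\<lambda>u. (u - m) powr (p - 1)) has_integral (t - m) powr p / p) {m..t}"
proof -
  have "((\<lambda>u. (u - m) powr (p - 1)) has_integral ((t - m) powr p / p - (m - m) powr p / p)) {m..t}"
  proof (rule fundamental_theorem_of_calculus_interior)
    show "continuous_on {m..t} (\<lambda>u. (u - m) powr p / p)"
      using assms by (intro continuous_intros continuous_on_powr') auto
    show "((\<lambda>u. (u - m) powr p / p) has_vector_derivative (x - m) powr (p - 1)) (at x)"
      if "x \<in> {m<..<t}" for x
      using that assms
      by (auto intro!: derivative_eq_intros simp flip: has_real_derivative_iff_has_vector_derivative)
  qed (use assms in auto)
  then show ?thesis by simp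
qed

context
  fixes H p :: real
  assumes H: "1 / 2 < H" "H < 1"
  defines "p \<equiv> H - 1 / 2"
begin

text \<open>The first factor is at most 1 since \<open>u \<le> 1\<close>, and the second is at most
  \<open>(u - m) powr (p - 1)\<close> since its exponent is negative and \<open>s \<le> m\<close>. A
  lower limit \<open>m\<close> separate from \<open>s\<close> covers both the full inner integral
  (\<open>m = s\<close>) and its increments (\<open>m = t\<close>).\<close>

lemma K_integrand_integrable:
  assumes "0 < s" "s \<le> m" "m \<le> t" "t \<le> 1"
  shows "set_integrable lebesgue {m..t} (\<lambda>u. u powr (H - 1 / 2) * (u - s) powr (H - 3 / 2))"
    and "norm (integral {m..t} (\<lambda>u. u powr (H - 1 / 2) * (u - s) powr (H - 3 / 2))) \<le> (t - m) powr p / p"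
proof -
  have p: "0 < p" "p < 1/2" using H by (auto simp: p_def)
  note I = has_integral_powr_shift[OF p(1) \<open>m \<le> t\<close>]
  \<comment> \<open>The point \<open>m\<close> is left out: the majorant is \<open>0\<close> there
    by the convention for \<open>0 powr\<close>, while the integrand is positive if
    \<open>s < m\<close>.\<close>
  have le: "norm (u powr (H - 1 / 2) * (u - s) powr (H - 3 / 2)) \<le> (u - m) powr (p - 1)"
    if "u \<in> {m..t} - {m}" for u
  proof -
    have "u powr (H - 1/2) \<le> 1" using that assms H by (intro powr_le1) auto
    moreover have "(u - s) powr (H - 3/2) \<le> (u - m) powr (H - 3/2)"
      using that assms H by (intro powr_mono2') auto
    ultimately have "u powr (H - 1/2) * (u - s) powr (H - 3/2) \<le> 1 * (u - m) powr (H - 3/2)"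
      by (intro mult_mono) auto
    then show ?thesis by (simp add: p_def)
  qed
  have set: "set_integrable lebesgue {m..t} (\<lambda>u. (u - m) powr (p - 1))"
    by (rule nonnegative_absolutely_integrable_1) (use I in \<open>auto simp: integrable_on_def\<close>)
  show int: "set_integrable lebesgue {m..t} (\<lambda>u. u powr (H - 1 / 2) * (u - s) powr (H - 3 / 2))"
  proof (rule set_integrable_bound[OF set])
    show "set_borel_measurable lebesgue {m..t} (\<lambda>u. u powr (H - 1 / 2) * (u - s) powr (H - 3 / 2))"
      unfolding set_borel_measurable_def by (intro measurable_completion) measurable
    have "AE x in lebesgue. x \<noteq> m"
      by (rule AE_completion[OF AE_lborel_singleton])
    then show "AE x in lebesgue. x \<in> {m..t} \<longrightarrow>
        norm (x powr (H - 1 / 2) * (x - s) powr (H - 3 / 2)) \<le> norm ((x - m) powr (p - 1))"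
      by eventually_elim (use le in auto)
  qed
  \<comment> \<open>Changing the integrand at the single point \<open>m\<close> makes the bound hold
    everywhere and keeps the integral.\<close>
  let ?\<phi> = "\<lambda>u. if u = m then 0 else u powr (H - 1 / 2) * (u - s) powr (H - 3 / 2)"
  have \<phi>: "(?\<phi> has_integral integral {m..t} (\<lambda>u. u powr (H - 1 / 2) * (u - s) powr (H - 3 / 2))) {m..t}"
    by (rule has_integral_spike[OF negligible_sing[of m] _ integrable_integral])
       (use set_lebesgue_integral_eq_integral(1)[OF int] in auto)
  have "norm (integral {m..t} ?\<phi>) \<le> integral {m..t} (\<lambda>u. (u - m) powr (p - 1))"
  proof (rule Henstock_Kurzweil_Integration.integral_norm_bound_integral)
    show "norm (?\<phi> u) \<le> (u - m) powr (p - 1)" if "u \<in> {m..t}" for u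
      using le[of u] that by (cases "u = m") auto
  qed (use I \<phi> in \<open>blast+\<close>)
  then show "norm (integral {m..t} (\<lambda>u. u powr (H - 1 / 2) * (u - s) powr (H - 3 / 2))) \<le> (t - m) powr p / p"
    unfolding integral_unique[OF I] integral_unique[OF \<phi>] .
qed

text \<open>The increment of the inner integral runs over \<open>{t..t'}\<close>, over
  \<open>{s..t'}\<close>, or is zero, according to the position of \<open>s\<close>. In each case it
  is at most \<open>(t' - t) powr p / p\<close>, uniformly in \<open>s\<close>; the singularity
  \<open>s powr (- p)\<close> comes from the prefactor alone.\<close>

lemma K_kernel_diff_bound:
  assumes "0 < s" "0 \<le> t" "t \<le> t'" "t' \<le> 1"
  shows "\<bar>K_kernel H t' s - K_kernel H t s\<bar> \<le> \<bar>c_H H\<bar> / p * (t' - t) powr p * s powr (- p)"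
proof -
  let ?\<phi> = "\<lambda>u. u powr (H - 1 / 2) * (u - s) powr (H - 3 / 2)"
  have p: "0 < p" using H by (auto simp: p_def)
  have K: "K_kernel H x s = c_H H * s powr (- p) * integral {s..x} ?\<phi>" if "s \<le> x" "x \<le> 1" for x
    using assms that set_lebesgue_integral_eq_integral(2)[OF K_integrand_integrable(1)[of s s x]]
    by (simp add: K_kernel_def p_def)
  have K0: "K_kernel H x s = 0" if "x < s" for x using that by (simp add: K_kernel_def)
  define J where "J = (if s \<le> t then integral {t..t'} ?\<phi> else if s \<le> t' then integral {s..t'} ?\<phi> else 0)"
  have "K_kernel H t' s - K_kernel H t s = c_H H * s powr (- p) * J"
  proof (cases "s \<le> t")
    case True
    have "integral {s..t} ?\<phi> + integral {t..t'} ?\<phi> = integral {s..t'} ?\<phi>"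
      using assms True
      by (intro Henstock_Kurzweil_Integration.integral_combine set_lebesgue_integral_eq_integral(1)[OF K_integrand_integrable(1)]) auto
    then show ?thesis using True assms by (simp add: K J_def algebra_simps flip: distrib_left)
  next
    case False
    then show ?thesis using assms by (auto simp: J_def K K0)
  qed
  moreover have "\<bar>J\<bar> \<le> (t' - t) powr p / p"
  proof -
    consider "s \<le> t" | "t < s" "s \<le> t'" | "t' < s" by linarith
    then show ?thesis
    proof cases
      case 1 then show ?thesis using assms K_integrand_integrable(2)[of s t t'] by (simp add: J_def)
    next
      case 2
      have "(t' - s) powr p / p \<le> (t' - t) powr p / p"
        using 2 p by (intro divide_right_mono powr_mono2) auto
      then show ?thesis using 2 assms K_integrand_integrable(2)[of s s t'] by (simp add: J_def)
    next
      case 3 then show ?thesis using p assms by (simp add: J_def)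
    qed
  qed
  moreover have "\<bar>c_H H * s powr (- p)\<bar> = \<bar>c_H H\<bar> * s powr (- p)"
    by (simp add: abs_mult)
  ultimately have "\<bar>K_kernel H t' s - K_kernel H t s\<bar> \<le> \<bar>c_H H\<bar> * s powr (- p) * ((t' - t) powr p / p)"
    by (metis abs_ge_zero abs_mult mult_left_mono)
  then show ?thesis by (simp add: mult_ac)
qed

text \<open>As an integral over the whole line against the sigma-finite \<open>lborel\<close>, the
  inner integral depends measurably on \<open>s\<close>, because its integrand is jointly
  Borel.\<close>

lemma borel_measurable_K_kernel: "K_kernel H t \<in> borel_measurable borel"
proof -
  have "K_kernel H t = (\<lambda>s. c_H H * s powr (1 / 2 - H) *
     (\<integral>u. (if s \<le> u \<and> u \<le> t then u powr (H - 1 / 2) * (u - s) powr (H - 3 / 2) else 0) \<partial>lborel) * indicator {0..t} s)"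
    (is "_ = (\<lambda>s. _ * (\<integral>u. ?g s u \<partial>lborel) * _)")
  proof
    fix s
    have "(LINT u:{s..t}|lebesgue. u powr (H - 1 / 2) * (u - s) powr (H - 3 / 2)) = integral\<^sup>L lebesgue (?g s)"
      unfolding set_lebesgue_integral_def by (intro Bochner_Integration.integral_cong) auto
    also have "\<dots> = integral\<^sup>L lborel (?g s)"
      by (rule integral_completion) measurable
    finally show "K_kernel H t s = c_H H * s powr (1 / 2 - H) * integral\<^sup>L lborel (?g s) * indicator {0..t} s"
      by (simp add: K_kernel_def)
  qed
  also have "\<dots> \<in> borel_measurable borel" by measurable
  finally show ?thesis .
qed

text \<open>Integrating the kernel estimate against \<open>norm (f s)\<close> shows that
  \<open>K_op H f\<close> is Hoelder continuous with exponent \<open>p\<close>; the constant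
  contains the weighted integral \<open>A\<close>.\<close>

lemma continuous_on_K_op:
  fixes f :: "real \<Rightarrow> real ^ 'n"
  assumes f[measurable]: "f \<in> borel_measurable (lebesgue_on {0..1})"
    and L2: "(\<integral>\<^sup>+t. ennreal ((norm (f t))\<^sup>2) \<partial>lebesgue_on {0..1}) < \<infinity>"
  shows "continuous_on {0..1} (K_op H f)"
proof -
  let ?M = "lebesgue_on {0..1::real}"
  define C where "C = \<bar>c_H H\<bar> / p"
  have p: "0 < p" "p < 1/2" using H by (auto simp: p_def)
  then have C: "0 \<le> C" by (simp add: C_def)
  have borel: "g \<in> borel_measurable ?M" if "g \<in> borel_measurable borel" for g :: "real \<Rightarrow> real"
    using that by (intro measurable_restrict_space1 measurable_completion) auto
  note [measurable] = borel[OF borel_measurable_K_kernel]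
  have [measurable]: "(\<lambda>s. s powr (- p)) \<in> borel_measurable ?M"
    by (rule borel) measurable
  \<comment> \<open>Here \<open>2 * p < 1\<close> enters: the weight \<open>s powr (- p)\<close> is
    square integrable near 0.\<close>
  have powr: "integrable ?M (\<lambda>s. s powr (- (2 * p)))"
    using p by (intro absolutely_integrable_imp_integrable nonnegative_absolutely_integrable_1
        integrable_on_powr_from_0) auto
  have sq: "integrable ?M (\<lambda>s. (norm (f s))\<^sup>2)"
    using L2 by (intro integrableI_bounded) (auto simp: power2_eq_square)
  have "integrable ?M (\<lambda>s. s powr (- p) * norm (f s))"
  proof (rule Bochner_Integration.integrable_bound)
    show "integrable ?M (\<lambda>s. s powr (- (2 * p)) + (norm (f s))\<^sup>2)"
      by (intro Bochner_Integration.integrable_add powr sq)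
    show "(\<lambda>s. s powr (- p) * norm (f s)) \<in> borel_measurable ?M"
      by measurable
    have "norm (s powr (- p) * norm (f s)) \<le> norm (s powr (- (2 * p)) + (norm (f s))\<^sup>2)" for s
    proof -
      have "s powr (- (2 * p)) = (s powr (- p))\<^sup>2"
        by (simp add: power2_eq_square flip: powr_add)
      moreover have "x * y \<le> x\<^sup>2 + y\<^sup>2" if "0 \<le> x" "0 \<le> y" for x y :: real
        using sum_squares_bound[of x y] that mult_nonneg_nonneg[of x y] by linarith
      ultimately show ?thesis by simp
    qed
    then show "AE s in ?M. norm (s powr (- p) * norm (f s)) \<le> norm (s powr (- (2 * p)) + (norm (f s))\<^sup>2)"
      by simp
  qed
  note W = integrable_mult_right[OF this]
  define A where "A = (\<integral>s. s powr (- p) * norm (f s) \<partial>?M)"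
  have "AE s in lebesgue. s \<noteq> (0::real)"
    by (rule AE_completion[OF AE_lborel_singleton])
  then have pos: "AE s in ?M. 0 < s"
    by (subst AE_restrict_space_iff) auto
  have kernel_int: "integrable ?M (\<lambda>s. K_kernel H t s *\<^sub>R f s)" if "t \<in> {0..1}" for t
  proof (rule Bochner_Integration.integrable_bound[OF W[of "C * t powr p"]])
    show "AE s in ?M. norm (K_kernel H t s *\<^sub>R f s) \<le> norm (C * t powr p * (s powr (- p) * norm (f s)))"
      using pos
    proof eventually_elim
      case (elim s)
      \<comment> \<open>The kernel vanishes at time 0, so the increment bound started there bounds
        the kernel itself.\<close>
      have "K_kernel H 0 s = 0" using elim by (simp add: K_kernel_def)
      then have "\<bar>K_kernel H t s\<bar> \<le> C * t powr p * s powr (- p)"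
        using K_kernel_diff_bound[of s 0 t] elim that by (simp add: C_def)
      then have "\<bar>K_kernel H t s\<bar> * norm (f s) \<le> C * t powr p * s powr (- p) * norm (f s)"
        by (rule mult_right_mono) simp
      then show ?case using C by (simp add: abs_mult mult.assoc)
    qed
  qed measurable
  \<comment> \<open>The kernel is zero for \<open>s > t\<close>, so all times share the domain
    \<open>{0..1}\<close> and values at two times can be subtracted under one integral.\<close>
  have K_op: "K_op H f t = (\<integral>s. K_kernel H t s *\<^sub>R f s \<partial>?M)" if "t \<in> {0..1}" for t
  proof -
    have "K_op H f t = (\<integral>s. indicator {0..1} s *\<^sub>R (K_kernel H t s *\<^sub>R f s) \<partial>lebesgue)"
      unfolding K_op_def set_lebesgue_integral_def
      using that by (intro Bochner_Integration.integral_cong) (auto simp: indicator_def K_kernel_def)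
    then show ?thesis by (simp add: integral_restrict_space)
  qed
  have hoelder: "norm (K_op H f t' - K_op H f t) \<le> C * (t' - t) powr p * A"
    if t: "t \<in> {0..1}" "t' \<in> {0..1}" "t \<le> t'" for t t'
  proof -
    have "K_op H f t' - K_op H f t = (\<integral>s. K_kernel H t' s *\<^sub>R f s - K_kernel H t s *\<^sub>R f s \<partial>?M)"
      using t by (simp add: K_op kernel_int)
    also have "norm \<dots> \<le> (\<integral>s. norm (K_kernel H t' s *\<^sub>R f s - K_kernel H t s *\<^sub>R f s) \<partial>?M)"
      by (rule integral_norm_bound)
    also have "\<dots> \<le> (\<integral>s. C * (t' - t) powr p * (s powr (- p) * norm (f s)) \<partial>?M)"
    proof (rule integral_mono_AE)
      show "AE s in ?M. norm (K_kernel H t' s *\<^sub>R f s - K_kernel H t s *\<^sub>R f s)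
          \<le> C * (t' - t) powr p * (s powr (- p) * norm (f s))"
        using pos
      proof eventually_elim
        case (elim s)
        have "\<bar>K_kernel H t' s - K_kernel H t s\<bar> * norm (f s) \<le> C * (t' - t) powr p * s powr (- p) * norm (f s)"
          using K_kernel_diff_bound[of s t t'] elim t by (intro mult_right_mono) (auto simp: C_def)
        then show ?case by (simp add: mult.assoc flip: scaleR_diff_left)
      qed
    qed (use t kernel_int W in auto)
    also have "\<dots> = C * (t' - t) powr p * A" by (simp add: A_def)
    finally show ?thesis .
  qed
  show ?thesis
    unfolding continuous_on_def
  proof
    fix x :: real assume x: "x \<in> {0..1}"
    have "((\<lambda>y. C * \<bar>y - x\<bar> powr p * A) \<longlongrightarrow> C * \<bar>x - x\<bar> powr p * A) (at x within {0..1})"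
      using p by (intro tendsto_intros tendsto_powr') auto
    then have lim: "((\<lambda>y. C * \<bar>y - x\<bar> powr p * A) \<longlongrightarrow> 0) (at x within {0..1})"
      using p by simp
    have bound: "norm (K_op H f y - K_op H f x) \<le> C * \<bar>y - x\<bar> powr p * A" if "y \<in> {0..1}" for y
    proof (cases "x \<le> y")
      case True
      then show ?thesis using hoelder[OF x that] by simp
    next
      case False
      then have "\<bar>y - x\<bar> = x - y" by simp
      then show ?thesis using hoelder[OF that x] False by (simp add: norm_minus_commute)
    qed
    have "\<forall>\<^sub>F y in at x within {0..1}. norm (K_op H f y - K_op H f x) \<le> C * \<bar>y - x\<bar> powr p * A"
      unfolding eventually_at_filter using bound by (intro always_eventually) blast
    then have "((\<lambda>y. K_op H f y - K_op H f x) \<longlongrightarrow> 0) (at x within {0..1})"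
      using lim by (rule Lim_null_comparison)
    then show "(K_op H f \<longlongrightarrow> K_op H f x) (at x within {0..1})"
      by (simp add: LIM_zero_iff)
  qed
qed

end

section \<open>The argument along a single path\<close>

text \<open>The parameters \<open>0\<close> and \<open>\<rho> i\<close> form a countable set, and
  \<open>T\<close> is to be a countable dense set of times, so that for almost every path all the
  assumptions hold at once. The function \<open>z\<close> stands for the noise common to all
  parameters.\<close>

lemma derivative_of_perturbed_solutions:
  fixes x :: "real \<Rightarrow> real \<Rightarrow> 'a::euclidean_space"
  assumes \<beta>: "set_integrable lebesgue {a..b} \<beta>"
    and \<rho>: "\<And>i. \<rho> i \<noteq> 0" "\<rho> \<longlonglongrightarrow> 0"
    and x: "\<And>r. r \<in> insert 0 (range \<rho>) \<Longrightarrow> set_integrable lebesgue {a..b} (x r)"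
    and eq: "\<And>r t. r \<in> insert 0 (range \<rho>) \<Longrightarrow> t \<in> {a..b} \<Longrightarrow>
      x r t = - (\<alpha> *\<^sub>R (LINT s:{a..t}|lebesgue. x r s)) + z t + r *\<^sub>R (LINT s:{a..t}|lebesgue. \<beta> s)"
    and T: "T \<subseteq> {a..b}" "{a..b} \<subseteq> closure T"
    and k: "continuous_on {a..b} k"
    and deriv: "\<And>t. t \<in> T \<Longrightarrow> ((\<lambda>r. x r t) has_vector_derivative k t) (at 0)"
  shows "AE t in lebesgue_on {a..b}.
    (k has_vector_derivative \<beta> t - \<alpha> *\<^sub>R k t) (at t within {a..b})"
proof -
  define D where "D i t = (x (\<rho> i) t - x 0 t) /\<^sub>R \<rho> i" for i t
  define F where "F t = integral {a..t} \<beta>" for t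
  have \<beta>_int: "\<beta> integrable_on {a..b}" by (rule set_lebesgue_integral_eq_integral(1)[OF \<beta>])
  have HK: "(LINT s:{a..t}|lebesgue. g s) = integral {a..t} g" "g integrable_on {a..t}"
    if "set_integrable lebesgue {a..b} g" "t \<in> {a..b}" for g :: "real \<Rightarrow> 'a" and t
    using that by (auto intro!: set_lebesgue_integral_eq_integral intro: set_integrable_subset)
  have D_int: "D i integrable_on {a..t}" if "t \<in> {a..b}" for i t
    unfolding D_def using that
    by (intro integrable_cmul integrable_diff HK(2) x) auto
  \<comment> \<open>The common \<open>z\<close> cancels in the difference, and division by
    \<open>\<rho> i\<close> normalises the perturbation, so the equation has the same inhomogeneity
    \<open>F\<close> for every \<open>i\<close>.\<close>
  have D_eq: "D i t = F t - \<alpha> *\<^sub>R integral {a..t} (D i)" if t: "t \<in> {a..b}" for i t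
  proof -
    have "integral {a..t} (D i) = (integral {a..t} (x (\<rho> i)) - integral {a..t} (x 0)) /\<^sub>R \<rho> i"
      unfolding D_def using t
      by (simp add: x HK(2) Henstock_Kurzweil_Integration.integral_diff)
    moreover have "x (\<rho> i) t - x 0 t
        = \<rho> i *\<^sub>R F t - \<alpha> *\<^sub>R (integral {a..t} (x (\<rho> i)) - integral {a..t} (x 0))"
      using t by (simp add: eq HK(1) x \<beta> F_def algebra_simps)
    then have "D i t = F t - \<alpha> *\<^sub>R ((integral {a..t} (x (\<rho> i)) - integral {a..t} (x 0)) /\<^sub>R \<rho> i)"
      using \<rho>(1)[of i] by (simp add: D_def scaleR_diff_right mult.commute)
    ultimately show ?thesis by simp
  qed
  have D_cont: "continuous_on {a..b} (D i)" for i
  proof (cases "a \<le> b")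
    case True
    have "continuous_on {a..b} (\<lambda>t. F t - \<alpha> *\<^sub>R integral {a..t} (D i))"
      unfolding F_def using D_int[of b i] True
      by (intro continuous_intros indefinite_integral_continuous_1 \<beta>_int) auto
    then show ?thesis by (rule continuous_on_eq) (simp add: D_eq)
  qed simp
  \<comment> \<open>Two quotients differ by a solution of the homogeneous equation; hence they do
    not depend on \<open>i\<close>.\<close>
  have D_unique: "D i t = D 0 t" if t: "t \<in> {a..b}" for i t
  proof -
    have "(\<lambda>t. D i t - D 0 t) t = 0"
    proof (rule linear_Volterra_unique[where c = "- \<alpha>", OF _ _ t])
      show "continuous_on {a..b} (\<lambda>t. D i t - D 0 t)"
        by (intro continuous_intros D_cont)
      show "D i t - D 0 t = - \<alpha> *\<^sub>R integral {a..t} (\<lambda>t. D i t - D 0 t)" if "t \<in> {a..b}" for t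
        using that D_eq[of t i] D_eq[of t 0]
        by (simp add: Henstock_Kurzweil_Integration.integral_diff D_int algebra_simps)
    qed
    then show ?thesis by simp
  qed
  \<comment> \<open>The sequence \<open>D i t\<close> is constant in \<open>i\<close> and converges
    to the derivative in \<open>r\<close>, so \<open>D 0 t\<close> already equals the limit.\<close>
  have "D 0 t = k t" if t: "t \<in> T" for t
  proof -
    have "((\<lambda>r. norm (x r t - x 0 t - r *\<^sub>R k t) / norm r) \<longlongrightarrow> 0) (at 0)"
      using deriv[OF t] unfolding has_vector_derivative_def has_derivative_at by simp
    moreover have "norm (x r t - x 0 t - r *\<^sub>R k t) / norm r = norm ((x r t - x 0 t) /\<^sub>R r - k t)"
      if "r \<noteq> 0" for r
    proof -
      have "(x r t - x 0 t) /\<^sub>R r - k t = (x r t - x 0 t - r *\<^sub>R k t) /\<^sub>R r"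
        using that by (simp add: scaleR_diff_right)
      then show ?thesis by (simp add: divide_inverse mult.commute)
    qed
    ultimately have "((\<lambda>r. norm ((x r t - x 0 t) /\<^sub>R r - k t)) \<longlongrightarrow> 0) (at 0)"
      by (simp cong: Lim_cong_within)
    then have "((\<lambda>r. (x r t - x 0 t) /\<^sub>R r) \<longlongrightarrow> k t) (at 0)"
      by (simp add: LIM_zero_iff tendsto_norm_zero_iff)
    moreover have "filterlim \<rho> (at 0) sequentially"
      using \<rho> by (simp add: filterlim_at)
    ultimately have "(\<lambda>i. D i t) \<longlonglongrightarrow> k t"
      unfolding D_def by (rule filterlim_compose)
    moreover have "(\<lambda>i. D i t) = (\<lambda>i. D 0 t)"
      using D_unique t T by blast
    ultimately show ?thesis by (metis LIMSEQ_const_iff)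
  qed
  then have D_k: "D 0 t - k t = 0" if "t \<in> T" for t using that by simp
  have T_closure: "closure T = {a..b}"
    using T by (metis closed_atLeastAtMost closure_minimal subset_antisym)
  have "continuous_on (closure T) (\<lambda>t. D 0 t - k t)"
    unfolding T_closure by (intro continuous_intros D_cont k)
  then have k_D: "D 0 t - k t = 0" if "t \<in> {a..b}" for t
    using continuous_constant_on_closure[of T "\<lambda>t. D 0 t - k t" 0 t] D_k that
    unfolding T_closure by blast
  \<comment> \<open>Equality of \<open>k\<close> and \<open>D 0\<close> on all of
    \<open>{a..b}\<close> transfers the Volterra equation to \<open>k\<close>, which is then
    differentiable wherever \<open>F\<close> is.\<close>
  have k_eq: "k t = F t - \<alpha> *\<^sub>R integral {a..t} k" if t: "t \<in> {a..b}" for t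
  proof -
    have "integral {a..t} (D 0) = integral {a..t} k"
      using k_D t by (intro Henstock_Kurzweil_Integration.integral_cong) auto
    then show ?thesis using D_eq[OF t, of 0] k_D[OF t] by simp
  qed
  have "AE t in lebesgue_on {a..b}. (F has_vector_derivative \<beta> t) (at t within {a..b})"
    unfolding F_def by (rule AE_has_vector_derivative_indefinite_integral[OF \<beta>_int])
  moreover have "AE t in lebesgue_on {a..b}. t \<in> {a..b}"
    by (rule AE_I2) simp
  ultimately show ?thesis
  proof eventually_elim
    case (elim t)
    have "((\<lambda>t. F t - \<alpha> *\<^sub>R integral {a..t} k) has_vector_derivative \<beta> t - \<alpha> *\<^sub>R k t) (at t within {a..b})"
      using elim
      by (intro has_vector_derivative_diff bounded_linear.has_vector_derivative[OF bounded_linear_scaleR_right]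
          integral_has_vector_derivative k)
    then show ?case
      by (rule has_vector_derivative_transform[OF elim(2), rotated]) (simp add: k_eq)
  qed
qed

section \<open>From almost sure statements to single paths\<close>

text \<open>A nonnegative function with finite integral is finite almost everywhere, here applied to
  the inner integral; sections of a jointly measurable function are measurable.\<close>

lemma L2_process_AE_section:
  assumes "L2_process M h"
  shows "AE \<omega> in M. (\<lambda>t. h t \<omega>) \<in> borel_measurable (lebesgue_on {0..1}) \<and>
    (\<integral>\<^sup>+t. ennreal ((norm (h t \<omega>))\<^sup>2) \<partial>lebesgue_on {0..1}) < \<infinity>"
proof -
  let ?L = "lebesgue_on {0..1::real}"
  have h: "(\<lambda>(t, \<omega>). h t \<omega>) \<in> borel_measurable (?L \<Otimes>\<^sub>M M)"
    and fin: "(\<integral>\<^sup>+\<omega>. (\<integral>\<^sup>+t. ennreal ((norm (h t \<omega>))\<^sup>2) \<partial>?L) \<partial>M) < \<infinity>"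
    using assms by (auto simp: L2_process_def)
  \<comment> \<open>Finiteness of the measure in time, with the factors swapped, gives measurability
    of the inner integral in \<open>\<omega>\<close>.\<close>
  interpret finite_measure ?L
    by (rule finite_measureI) (simp add: emeasure_restrict_space)
  have [measurable]: "(\<lambda>(\<omega>, t). h t \<omega>) \<in> borel_measurable (M \<Otimes>\<^sub>M ?L)"
    using measurable_pair_swap[OF h] by (simp add: case_prod_beta)
  have "AE \<omega> in M. (\<integral>\<^sup>+t. ennreal ((norm (h t \<omega>))\<^sup>2) \<partial>?L) \<noteq> \<infinity>"
  proof (rule nn_integral_PInf_AE)
    show "(\<lambda>\<omega>. \<integral>\<^sup>+t. ennreal ((norm (h t \<omega>))\<^sup>2) \<partial>?L) \<in> borel_measurable M"
      by measurable
  qed (use fin in auto)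
  moreover have "(\<lambda>t. h t \<omega>) \<in> borel_measurable ?L" if "\<omega> \<in> space M" for \<omega>
    using measurable_Pair1[OF h that] by simp
  ultimately show ?thesis by (auto simp: less_top)
qed

theorem proposition3p1:
  fixes \<alpha> H \<epsilon> :: real
    and \<nu> :: "(real \<Rightarrow> real ^ 'n) measure"
    and B \<beta> h :: "real \<Rightarrow> (real \<Rightarrow> real ^ 'n) \<Rightarrow> real ^ 'n"
    and X :: "real \<Rightarrow> real \<Rightarrow> (real \<Rightarrow> real ^ 'n) \<Rightarrow> real ^ 'n"
  assumes "0 < \<alpha>" and "1 / 2 < H" and "H < 1" and "0 < \<epsilon>"
    and "fractional_OU_measure \<alpha> H \<nu> B"
    and "AE \<omega> in completion \<nu>. set_integrable lebesgue {0..1} (\<lambda>s. \<beta> s \<omega>)"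
    and "\<And>r. r \<in> {-\<epsilon><..<\<epsilon>} \<Longrightarrow>
           langevin_solution \<alpha> (completion \<nu>) (perturbed B \<beta> r) (X r)"
    and "\<And>r. r \<in> {-\<epsilon><..<\<epsilon>} \<Longrightarrow>
           AE \<omega> in completion \<nu>. (\<lambda>t\<in>{0..1}. X r t \<omega>) \<in> Omega"
    and "L2_process (completion \<nu>) h"
    and "\<And>t. t \<in> {0..1} \<Longrightarrow>
           AE \<omega> in completion \<nu>.
             ((\<lambda>r. X r t \<omega>) has_vector_derivative K_op H (\<lambda>s. h s \<omega>) t) (at 0)"
  shows "AE \<omega> in completion \<nu>. AE t in lebesgue_on {0..1}.
           (\<lambda>u. K_op H (\<lambda>s. h s \<omega>) u) differentiable (at t within {0..1}) \<and>
           \<beta> t \<omega> =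
             vector_derivative (\<lambda>u. K_op H (\<lambda>s. h s \<omega>) u) (at t within {0..1})
             + \<alpha> *\<^sub>R K_op H (\<lambda>s. h s \<omega>) t"
proof -
  \<comment> \<open>The shift by 2 keeps even \<open>\<rho> 0 = \<epsilon> / 2\<close> inside the
    open interval; a shift by 1 would start at \<open>\<epsilon>\<close> itself.\<close>
  define \<rho> where "\<rho> i = \<epsilon> / real (i + 2)" for i
  have \<rho>: "\<rho> i \<noteq> 0" "\<bar>\<rho> i\<bar> < \<epsilon>" for i
    using \<open>0 < \<epsilon>\<close> by (auto simp: \<rho>_def field_simps add_pos_nonneg)
  have \<rho>_lim: "\<rho> \<longlonglongrightarrow> 0"
    unfolding \<rho>_def by real_asymp
  define R where "R = insert 0 (range \<rho>)"
  have R: "countable R" "R \<subseteq> {-\<epsilon><..<\<epsilon>}"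
    using \<rho>(2) \<open>0 < \<epsilon>\<close> by (auto simp: R_def abs_less_iff minus_less_iff)
  obtain T :: "real set" where T: "countable T" "T \<subseteq> {0..1}" "{0..1} \<subseteq> closure T"
    using separable[of "{0..1::real}"] by blast
  have "AE \<omega> in completion \<nu>. \<forall>r\<in>R. set_integrable lebesgue {0..1} (\<lambda>s. X r s \<omega>) \<and>
      (\<forall>t\<in>{0..1}. X r t \<omega> - X r 0 \<omega> = - (\<alpha> *\<^sub>R (LINT s:{0..t}|lebesgue. X r s \<omega>))
         + (perturbed B \<beta> r t \<omega> - perturbed B \<beta> r 0 \<omega>))"
    using assms(7) R unfolding langevin_solution_def by (intro AE_ball_countable') auto
  moreover have "AE \<omega> in completion \<nu>. \<forall>r\<in>R. (\<lambda>t\<in>{0..1}. X r t \<omega>) \<in> Omega"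
    using assms(8) R by (intro AE_ball_countable') auto
  moreover have "AE \<omega> in completion \<nu>. \<forall>t\<in>T.
      ((\<lambda>r. X r t \<omega>) has_vector_derivative K_op H (\<lambda>s. h s \<omega>) t) (at 0)"
    using assms(10) T by (intro AE_ball_countable') auto
  moreover note assms(6) L2_process_AE_section[OF assms(9)]
  ultimately show ?thesis
  proof eventually_elim
    case (elim \<omega>)
    define k where "k = K_op H (\<lambda>s. h s \<omega>)"
    \<comment> \<open>Membership in \<open>Omega\<close> fixes the initial value, so the increments
      in the Langevin equation become values.\<close>
    have X0: "X r 0 \<omega> = 0" if "r \<in> R" for r
      using elim(2) that by (force simp: Omega_def)
    have "AE t in lebesgue_on {0..1}.
        (k has_vector_derivative \<beta> t \<omega> - \<alpha> *\<^sub>R k t) (at t within {0..1})"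
    proof (rule derivative_of_perturbed_solutions[OF elim(4) \<rho>(1) \<rho>_lim])
      show "continuous_on {0..1} k"
        unfolding k_def using elim(5) assms(2,3) by (intro continuous_on_K_op) auto
      show "X r t \<omega> = - (\<alpha> *\<^sub>R (LINT s:{0..t}|lebesgue. X r s \<omega>)) + (B t \<omega> - B 0 \<omega>)
          + r *\<^sub>R (LINT s:{0..t}|lebesgue. \<beta> s \<omega>)"
        if "r \<in> insert 0 (range \<rho>)" "t \<in> {0..1}" for r t
      proof -
        \<comment> \<open>The perturbation is an integral over one point at time 0, so the common
          noise is \<open>B t \<omega> - B 0 \<omega>\<close> for every \<open>r\<close>.\<close>
        have "(LINT s:{0..0}|lebesgue. \<beta> s \<omega>) = 0"
          unfolding set_lebesgue_integral_def
          by (rule integral_eq_zero_AE) (use AE_completion[OF AE_lborel_singleton[of "0::real"]] in \<open>auto elim!: eventually_mono\<close>)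
        then show ?thesis
          using elim(1) X0 that by (auto simp: R_def perturbed_def)
      qed
    qed (use elim T in \<open>auto simp: R_def k_def\<close>)
    moreover have "AE t in lebesgue_on {0..1}. t \<in> {0..1::real}"
      by (rule AE_I2) simp
    ultimately show ?case
    proof eventually_elim
      case (elim t)
      \<comment> \<open>The interval is nondegenerate, so the derivative within it is unique, also
        at the endpoints.\<close>
      have "vector_derivative k (at t within {0..1}) = \<beta> t \<omega> - \<alpha> *\<^sub>R k t"
        using elim vector_derivative_within_cbox[of 0 1 t k] by auto
      then show ?case
        using elim by (auto simp: k_def differentiableI_vector)
    qed
  qed
qed

end
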